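(* Let $G=(I,A,\iota,(u_i)_{i\in I})$ be a game with infinite past. Let the set $P_n$ of positions in stage $n$, for each $n\in\mathbb{Z}_0$, and the set $R$ of runs be endowed with the product topology (with $A$ discrete). Assume that: (C1) for each $n\in\mathbb{Z}_0$, the function $\iota_n:P_n\to I$, the restriction of $\iota$ to $P_n$, which assigns the active player to each position in stage $n$, is continuous (with $I$ discrete); (C2) the payoff function $u_i:R\to\mathbb{R}$ of each player $i\in I$ is continuous. Then $G$ admits an equilibrium.
   Context: Let $\mathbb{Z}_0=\{\ldots,-2,-1,0\}$ and, for $n\in\mathbb{Z}_0$, $\mathbb{Z}_n=\{\ldots,n-1,n\}$. A game with infinite past is a tuple $G=(I,A,\iota,(u_i)_{i\in I})$ where $I$ is a nonempty finite set of players; $A$ is a finite set of actions with $|A|\ge 2$; a position in stage $n\in\mathbb{Z}_0$ is a sequence $p_n=(\ldots,a_{n-2},a_{n-1})\in P_n:=A^{\mathbb{Z}_{n-1}}$, and $P=\bigcup_{n\in\mathbb{Z}_0}P_n$ (a disjoint union); a run is a sequence $r=(\ldots,a_{-1},a_0)\in R:=A^{\mathbb{Z}_0}$; $\iota:P\to I$ assigns to each position the player who controls it (the active player); $u_i:R\to\mathbb{R}$ is a bounded payoff function for each $i\in I$. For a run $r=(\ldots,a_{-1},a_0)$, $r_{<n}=(\ldots,a_{n-2},a_{n-1})$ is the position in stage $n$ along $r$. A strategy of player $i$ is a map $s_i:\{p\in P:\iota(p)=i\}\to A$; a strategy profile is $s=(s_i)_{i\in I}$. A run $r=(\ldots,a_{-1},a_0)$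 is consistent with $s_i$ if $a_n=s_i(r_{<n})$ for every $n\in\mathbb{Z}_0$ with $\iota(r_{<n})=i$; it is consistent with $s$ if it is consistent with every $s_i$. $R(s)$ is the set of runs consistent with $s$. For a position $p_n\in P_n$, the subgame $G[p_n]$ is the finite game played in stages $n,\ldots,-1,0$ that arises when the actions up to stage $n-1$ are given by $p_n$; a strategy profile $s$ induces a strategy profile $s[p_n]$ in it. A traditional equilibrium of $G[p_n]$ is a pure Nash equilibrium of this finite game. Equilibrium: a pair $(s,r)$, with $s$ a strategy profile and $r\in R(s)$, such that for each $n\in\mathbb{Z}_0$, $s[r_{<n}]$ is a traditional equilibrium of $G[r_{<n}]$. *)

theory Defs
  imports "HOL-Analysis.Analysis"
begin

text \<open>
  A common format for the games with infinite past, played in the stages \<open>{..0}\<close>, and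
  their subgames, played in the finitely many stages \<open>{n..0}\<close>. A sequence of actions is a
  function on the integers that is \<open>undefined\<close> outside its set of stages. The domain alone
  does not always determine the stage of a position (\<open>undefined\<close> may be an action), so the
  disjoint union of the sets of positions consists of pairs of a stage and a position in it.
\<close>

record ('i, 'a) game =
  players :: "'i set"
  actions :: "'a set"
  stages :: "int set"
  active :: "int \<Rightarrow> (int \<Rightarrow> 'a) \<Rightarrow> 'i"
  payoff :: "'i \<Rightarrow> (int \<Rightarrow> 'a) \<Rightarrow> real"

type_synonym ('i, 'a) profile = "'i \<Rightarrow> int \<times> (int \<Rightarrow> 'a) \<Rightarrow> 'a"

definition stages_before :: "('i, 'a) game \<Rightarrow> int \<Rightarrow> int set" where
  "stages_before G n = {m \<in> stages G. m < n}"

definition positions :: "('i, 'a) game \<Rightarrow> int \<Rightarrow> (int \<Rightarrow> 'a) set" where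
  "positions G n = stages_before G n \<rightarrow>\<^sub>E actions G"

definition runs :: "('i, 'a) game \<Rightarrow> (int \<Rightarrow> 'a) set" where
  "runs G = stages G \<rightarrow>\<^sub>E actions G"

definition position_along :: "('i, 'a) game \<Rightarrow> (int \<Rightarrow> 'a) \<Rightarrow> int \<Rightarrow> (int \<Rightarrow> 'a)" where
  "position_along G r n = restrict r (stages_before G n)"

definition infinite_past_game :: "('i, 'a) game \<Rightarrow> bool" where
  "infinite_past_game G \<longleftrightarrow>
     finite (players G) \<and> players G \<noteq> {} \<and>
     finite (actions G) \<and> card (actions G) \<ge> 2 \<and>
     stages G = {..0} \<and>
     (\<forall>n\<in>stages G. \<forall>p\<in>positions G n. active G n p \<in> players G) \<and>
     (\<forall>i\<in>players G. bounded (payoff G i ` runs G))"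

definition controlled :: "('i, 'a) game \<Rightarrow> 'i \<Rightarrow> (int \<times> (int \<Rightarrow> 'a)) set" where
  "controlled G i = {(n, p). n \<in> stages G \<and> p \<in> positions G n \<and> active G n p = i}"

definition strategies :: "('i, 'a) game \<Rightarrow> 'i \<Rightarrow> (int \<times> (int \<Rightarrow> 'a) \<Rightarrow> 'a) set" where
  "strategies G i = controlled G i \<rightarrow>\<^sub>E actions G"

definition profiles :: "('i, 'a) game \<Rightarrow> ('i, 'a) profile set" where
  "profiles G = (\<Pi>\<^sub>E i\<in>players G. strategies G i)"

definition consistent ::
  "('i, 'a) game \<Rightarrow> 'i \<Rightarrow> (int \<times> (int \<Rightarrow> 'a) \<Rightarrow> 'a) \<Rightarrow> (int \<Rightarrow> 'a) \<Rightarrow> bool" where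
  "consistent G i t r \<longleftrightarrow>
     (\<forall>n\<in>stages G. active G n (position_along G r n) = i \<longrightarrow> r n = t (n, position_along G r n))"

definition consistent_runs :: "('i, 'a) game \<Rightarrow> ('i, 'a) profile \<Rightarrow> (int \<Rightarrow> 'a) set" where
  "consistent_runs G s = {r \<in> runs G. \<forall>i\<in>players G. consistent G i (s i) r}"


subsection \<open>Finite games\<close>

text \<open>
  In a game with finitely many stages every strategy profile has exactly one consistent run
  (lemma \<open>ex1_consistent_run\<close> below). In a game with infinite past there may be none or several.
\<close>

definition outcome :: "('i, 'a) game \<Rightarrow> ('i, 'a) profile \<Rightarrow> (int \<Rightarrow> 'a)" where
  "outcome F s = (THE r. r \<in> consistent_runs F s)"

definition nash_equilibrium :: "('i, 'a) game \<Rightarrow> ('i, 'a) profile \<Rightarrow> bool" where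
  "nash_equilibrium F s \<longleftrightarrow>
     s \<in> profiles F \<and>
     (\<forall>i\<in>players F. \<forall>t\<in>strategies F i.
        payoff F i (outcome F (s(i := t))) \<le> payoff F i (outcome F s))"


subsection \<open>Subgames and equilibria\<close>

definition append_from :: "int \<Rightarrow> (int \<Rightarrow> 'a) \<Rightarrow> (int \<Rightarrow> 'a) \<Rightarrow> (int \<Rightarrow> 'a)" where
  "append_from n p h = (\<lambda>m. if m < n then p m else h m)"

definition subgame :: "('i, 'a) game \<Rightarrow> int \<Rightarrow> (int \<Rightarrow> 'a) \<Rightarrow> ('i, 'a) game" where
  "subgame G n p =
     \<lparr>players = players G,
      actions = actions G,
      stages = {m \<in> stages G. n \<le> m},
      active = (\<lambda>m h. active G m (append_from n p h)),
      payoff = (\<lambda>i h. payoff G i (append_from n p h))\<rparr>"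

definition induced_profile ::
  "('i, 'a) game \<Rightarrow> ('i, 'a) profile \<Rightarrow> int \<Rightarrow> (int \<Rightarrow> 'a) \<Rightarrow> ('i, 'a) profile" where
  "induced_profile G s n p =
     (\<lambda>i\<in>players G. \<lambda>(m, h)\<in>controlled (subgame G n p) i. s i (m, append_from n p h))"

definition equilibrium :: "('i, 'a) game \<Rightarrow> ('i, 'a) profile \<Rightarrow> (int \<Rightarrow> 'a) \<Rightarrow> bool" where
  "equilibrium G s r \<longleftrightarrow>
     s \<in> profiles G \<and> r \<in> consistent_runs G s \<and>
     (\<forall>n\<in>stages G. nash_equilibrium (subgame G n (position_along G r n))
                                     (induced_profile G s n (position_along G r n)))"


subsection \<open>Topology\<close>

definition position_topology :: "('i, 'a) game \<Rightarrow> int \<Rightarrow> (int \<Rightarrow> 'a) topology" where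
  "position_topology G n = product_topology (\<lambda>_. discrete_topology (actions G)) (stages_before G n)"

definition run_topology :: "('i, 'a) game \<Rightarrow> (int \<Rightarrow> 'a) topology" where
  "run_topology G = product_topology (\<lambda>_. discrete_topology (actions G)) (stages G)"

lemma topspace_position_topology: "topspace (position_topology G n) = positions G n"
  by (simp add: position_topology_def positions_def)

lemma topspace_run_topology: "topspace (run_topology G) = runs G"
  by (simp add: run_topology_def runs_def)


subsection \<open>Well-definedness of outcomes and subgames\<close>

lemma position_along_in_positions:
  assumes "r \<in> runs G"
  shows "position_along G r n \<in> positions G n"
  using assms by (auto simp: position_along_def positions_def runs_def stages_before_def)

lemma positions_cong:
  assumes "\<And>m. m \<in> stages_before G n \<Longrightarrow> r m = r' m"
  shows "position_along G r n = position_along G r' n"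
  using assms by (auto simp: position_along_def restrict_def)

lemma consistent_runs_iff:
  assumes act: "\<And>n p. n \<in> stages F \<Longrightarrow> p \<in> positions F n \<Longrightarrow> active F n p \<in> players F"
  shows "r \<in> consistent_runs F s \<longleftrightarrow> r \<in> runs F \<and>
    (\<forall>n\<in>stages F. r n = s (active F n (position_along F r n)) (n, position_along F r n))"
  using act position_along_in_positions[of r F]
  unfolding consistent_runs_def consistent_def by blast

lemma ex1_consistent_run:
  assumes fin: "finite (stages F)"
    and act: "\<And>n p. n \<in> stages F \<Longrightarrow> p \<in> positions F n \<Longrightarrow> active F n p \<in> players F"
    and s: "s \<in> profiles F"
  shows "\<exists>!r. r \<in> consistent_runs F s"
proof -
  define f where "f r n = s (active F n (position_along F r n)) (n, position_along F r n)" for r n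
  have f_cong: "f r n = f r' n" if "\<And>m. m \<in> stages F \<Longrightarrow> m < n \<Longrightarrow> r m = r' m" for r r' n
    using positions_cong[of F n r r'] that by (auto simp: f_def stages_before_def)
  have f_in: "f r n \<in> actions F"
    if "n \<in> stages F" "position_along F r n \<in> positions F n" for r n
  proof -
    let ?p = "position_along F r n"
    have "s (active F n ?p) \<in> strategies F (active F n ?p)"
      using s act[OF that] by (auto simp: profiles_def)
    moreover have "(n, ?p) \<in> controlled F (active F n ?p)"
      using that by (auto simp: controlled_def)
    ultimately show ?thesis
      by (auto simp: f_def strategies_def)
  qed
  have iff: "r \<in> consistent_runs F s \<longleftrightarrow> r \<in> runs F \<and> (\<forall>n\<in>stages F. r n = f r n)" for r
    using consistent_runs_iff[OF act] by (simp add: f_def)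
  have ex: "\<exists>r. r \<in> D \<rightarrow>\<^sub>E actions F \<and> (\<forall>n\<in>D. r n = f r n)"
    if "finite D" "D \<subseteq> stages F" "\<And>m n. n \<in> D \<Longrightarrow> m \<in> stages F \<Longrightarrow> m < n \<Longrightarrow> m \<in> D" for D
    using that
  proof (induction D rule: finite_linorder_max_induct)
    case empty
    show ?case by (rule exI[of _ "\<lambda>_. undefined"]) auto
  next
    case (insert b D)
    obtain r where r: "r \<in> D \<rightarrow>\<^sub>E actions F" "\<forall>n\<in>D. r n = f r n"
    proof -
      have "\<And>m n. n \<in> D \<Longrightarrow> m \<in> stages F \<Longrightarrow> m < n \<Longrightarrow> m \<in> D"
        using insert.hyps(2) insert.prems(2) by (metis insert_iff order_less_asym)
      then show ?thesis
        using insert.IH insert.prems(1) that by blast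
    qed
    have below: "m \<in> D" if "m \<in> stages F" "m < b" for m
      using insert.prems(2)[of b m] that by auto
    have pos: "position_along F r b \<in> positions F b"
      using r(1) below by (auto simp: position_along_def positions_def stages_before_def)
    have f_b: "f r b \<in> actions F"
      using insert.prems(1) pos by (intro f_in) auto
    have same: "f (r(b := f r b)) n = f r n" if "n \<le> b" for n
      using that by (intro f_cong) auto
    have "\<forall>n\<in>insert b D. (r(b := f r b)) n = f (r(b := f r b)) n"
      using r(2) insert.hyps(2) same by (force simp: less_imp_le)
    moreover have "r(b := f r b) \<in> insert b D \<rightarrow>\<^sub>E actions F"
      using r(1) f_b by (auto simp: PiE_iff extensional_def)
    ultimately show ?case by blast
  qed
  have unique: "r = r'" if "r \<in> consistent_runs F s" "r' \<in> consistent_runs F s" for r r'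
  proof (rule ccontr)
    assume "r \<noteq> r'"
    then have ne: "{n \<in> stages F. r n \<noteq> r' n} \<noteq> {}"
      using that by (auto simp: iff runs_def PiE_iff extensional_def) (metis ext)
    define n where "n = Min {n \<in> stages F. r n \<noteq> r' n}"
    have n: "n \<in> stages F" "r n \<noteq> r' n"
      using Min_in[OF _ ne] fin by (auto simp: n_def)
    have "r m = r' m" if "m \<in> stages F" "m < n" for m
      using that fin Min_le[of "{n \<in> stages F. r n \<noteq> r' n}" m] by (fastforce simp: n_def)
    then have "f r n = f r' n" by (rule f_cong)
    with n that show False by (simp add: iff)
  qed
  have "\<exists>r. r \<in> consistent_runs F s"
    using ex[OF fin] by (auto simp: iff runs_def)
  with unique show ?thesis by blast
qed

context
  fixes G :: "('i, 'a) game" and n :: int and p :: "int \<Rightarrow> 'a"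
  assumes G: "infinite_past_game G" and n: "n \<in> stages G" and p: "p \<in> positions G n"
begin

lemma append_from_in_positions:
  "h \<in> positions (subgame G n p) m \<Longrightarrow> n \<le> m \<Longrightarrow> append_from n p h \<in> positions G m"
  using G p by (auto simp: infinite_past_game_def append_from_def positions_def subgame_def
      stages_before_def PiE_iff extensional_def)

lemma append_from_in_runs: "z \<in> runs (subgame G n p) \<Longrightarrow> append_from n p z \<in> runs G"
  using G n p by (auto simp: infinite_past_game_def append_from_def positions_def subgame_def
      runs_def stages_before_def PiE_iff extensional_def)

lemma finite_stages_subgame: "finite (stages (subgame G n p))"
proof -
  have "stages (subgame G n p) = {n..0}"
    using G by (auto simp: infinite_past_game_def subgame_def)
  then show ?thesis by simp
qed

lemma active_subgame_in_players:
  assumes "m \<in> stages (subgame G n p)" "h \<in> positions (subgame G n p) m"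
  shows "active (subgame G n p) m h \<in> players (subgame G n p)"
  using assms append_from_in_positions[of h m] G by (auto simp: subgame_def infinite_past_game_def)

lemma induced_profile_in_profiles:
  assumes s: "s \<in> profiles G"
  shows "induced_profile G s n p \<in> profiles (subgame G n p)"
proof -
  have "s i (m, append_from n p h) \<in> actions G"
    if "i \<in> players G" "(m, h) \<in> controlled (subgame G n p) i" for i m h
  proof -
    have "(m, append_from n p h) \<in> controlled G i"
      using that append_from_in_positions[of h m] by (auto simp: controlled_def subgame_def)
    then show ?thesis
      using s that(1) by (auto simp: profiles_def strategies_def)
  qed
  moreover have "players (subgame G n p) = players G" "actions (subgame G n p) = actions G"
    by (simp_all add: subgame_def)
  ultimately show ?thesis
    by (auto simp: induced_profile_def profiles_def strategies_def)
qed

lemma ex1_consistent_run_subgame: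
  "s \<in> profiles (subgame G n p) \<Longrightarrow> \<exists>!z. z \<in> consistent_runs (subgame G n p) s"
  using ex1_consistent_run finite_stages_subgame active_subgame_in_players by metis

end

end

theory Submission
  imports Defs
begin

text \<open>
  Let \<open>v\<^sub>i(p)\<close> be the minmax value of player \<open>i\<close> at the position \<open>p\<close>, where all the other players
  cooperate against \<open>i\<close>. A run \<open>r\<close> is the run of an equilibrium as soon as
  \<open>v\<^sub>i(r\<^sub>n) \<le> u\<^sub>i(r)\<close> for every player \<open>i\<close> and every position \<open>r\<^sub>n\<close> along \<open>r\<close>: the players follow
  \<open>r\<close>, and after the first deviation from \<open>r\<close> all the others minimise the value of the deviator.
  If every active player maximises the own minmax value from some stage on, then the minmax
  values of all players are nondecreasing from that stage on, so the inequalities for the stages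
  in \<open>{n..0}\<close> can be satisfied. By continuity they define closed sets of runs, decreasing as
  \<open>n\<close> tends to \<open>- \<infinity>\<close>, and the space of runs is compact.
\<close>

section \<open>Minmax values and the trigger profile\<close>

text \<open>
  The value \<open>minmax_value G k i r\<close> belongs to the position of \<open>r\<close> in stage \<open>1 - k\<close>. Taking a whole run
  as the argument (see \<open>minmax_value_cong\<close>) makes all the values functions on the same space.
\<close>

primrec minmax_value :: "('i, 'a) game \<Rightarrow> nat \<Rightarrow> 'i \<Rightarrow> (int \<Rightarrow> 'a) \<Rightarrow> real" where
  "minmax_value G 0 i r = payoff G i r"
| "minmax_value G (Suc k) i r =
    (if active G (- int k) (position_along G r (- int k)) = i
     then SUP b\<in>actions G. minmax_value G k i (r(- int k := b))
     else INF b\<in>actions G. minmax_value G k i (r(- int k := b)))"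

text \<open>Here \<open>l\<close> is the stage of the first deviation from \<open>r\<close> and
  \<open>j\<close> the deviator. If \<open>D\<close> is infinite, there is no first deviation and
  \<open>Min D\<close> is meaningless, hence the default \<open>r m\<close>; at positions in the
  subgames along \<open>r\<close>, \<open>D\<close> is finite. The index \<open>nat (- m)\<close>
  selects the value right after stage \<open>m\<close>, where \<open>b\<close> has just been played;
  the tail of \<open>r\<close> only completes \<open>q\<close> to a run.\<close>

definition trigger_profile ::
  "('i, 'a) game \<Rightarrow> (int \<Rightarrow> 'a) \<Rightarrow> ('i, 'a) profile" where
  "trigger_profile G r =
    (\<lambda>i\<in>players G. \<lambda>(m, q)\<in>controlled G i.
      let D = {l. l < m \<and> q l \<noteq> r l}; l = Min D; j = active G l (position_along G r l) in
      if finite D \<and> D \<noteq> {}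
      then arg_min_on (\<lambda>b. minmax_value G (nat (- m)) j ((append_from m q r)(m := b))) (actions G)
      else r m)"

context
  fixes G :: "('i, 'a) game"
  assumes G: "infinite_past_game G"
begin

lemma stages_eq [simp]: "stages G = {..0}"
  using G by (simp add: infinite_past_game_def)

lemma finite_actions: "finite (actions G)"
  using G by (simp add: infinite_past_game_def)

lemma actions_nonempty: "actions G \<noteq> {}"
  using G by (auto simp: infinite_past_game_def)

lemma active_in_players:
  assumes "r \<in> runs G" "n \<le> 0"
  shows "active G n (position_along G r n) \<in> players G"
  using G position_along_in_positions[OF assms(1)] assms(2) by (auto simp: infinite_past_game_def)

lemma run_upd: "r \<in> runs G \<Longrightarrow> b \<in> actions G \<Longrightarrow> n \<le> 0 \<Longrightarrow> r(n := b) \<in> runs G"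
  by (auto simp: runs_def PiE_iff extensional_def)

section \<open>Minmax values along a run\<close>

text \<open>The recursion overwrites the stages from \<open>1 - int k\<close> to 0. Agreement beyond
  stage 0 is required because payoffs take functions on all integers; for runs it holds, both being
  \<open>undefined\<close> there.\<close>

lemma minmax_value_cong:
  assumes "\<And>l. l \<le> - int k \<or> 0 < l \<Longrightarrow> r l = r' l"
  shows "minmax_value G k i r = minmax_value G k i r'"
  using assms
proof (induction k arbitrary: r r')
  case 0
  then have "r = r'"
    by (intro ext) (metis linorder_not_less minus_zero of_nat_0)
  then show ?case by simp
next
  case (Suc k)
  have "position_along G r (- int k) = position_along G r' (- int k)"
    by (rule positions_cong) (use Suc.prems in \<open>auto simp: stages_before_def\<close>)
  moreover have "minmax_value G k i (r(- int k := b)) = minmax_value G k i (r'(- int k := b))" for b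
    by (rule Suc.IH) (use Suc.prems in auto)
  ultimately show ?case by simp
qed

text \<open>The supremum includes the action actually taken. This bounds a deviator: no own move can
  raise the own value.\<close>

lemma minmax_value_Suc_ge_active:
  assumes "active G (- int k) (position_along G r (- int k)) = i" "r (- int k) \<in> actions G"
  shows "minmax_value G k i r \<le> minmax_value G (Suc k) i r"
proof -
  have "minmax_value G k i (r(- int k := r (- int k)))
      \<le> (SUP b\<in>actions G. minmax_value G k i (r(- int k := b)))"
    using assms(2) finite_actions by (intro cSUP_upper) auto
  then show ?thesis using assms(1) by simp
qed

text \<open>Dual to the active case: a move of another player cannot lower the value.\<close>

lemma minmax_value_Suc_le_inactive:
  assumes "active G (- int k) (position_along G r (- int k)) \<noteq> i" "r (- int k) \<in> actions G"
  shows "minmax_value G (Suc k) i r \<le> minmax_value G k i r"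
proof -
  have "(INF b\<in>actions G. minmax_value G k i (r(- int k := b)))
      \<le> minmax_value G k i (r(- int k := r (- int k)))"
    using assms(2) finite_actions by (intro cINF_lower) auto
  then show ?thesis using assms(1) by simp
qed

section \<open>Continuity of the minmax values and compactness\<close>

lemma continuous_map_run_upd:
  assumes "b \<in> actions G" "n \<le> 0"
  shows "continuous_map (run_topology G) (run_topology G) (\<lambda>r. r(n := b))"
proof -
  have "continuous_map (run_topology G) (discrete_topology (actions G)) (\<lambda>r. (r(n := b)) l)"
    if "l \<le> 0" for l
    using that assms
    by (cases "l = n") (auto simp: run_topology_def intro: continuous_map_product_projection)
  moreover have "(\<lambda>r. r(n := b)) \<in> topspace (run_topology G) \<rightarrow> extensional (stages G)"
    using assms by (auto simp: topspace_run_topology runs_def PiE_iff extensional_def)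
  ultimately show ?thesis
    unfolding run_topology_def
    by (subst continuous_map_componentwise) (auto simp: run_topology_def)
qed

lemma continuous_map_position_along:
  "continuous_map (run_topology G) (position_topology G n) (\<lambda>r. position_along G r n)"
  unfolding run_topology_def position_topology_def continuous_map_componentwise
  by (auto simp: position_along_def stages_before_def intro: continuous_map_product_projection)

lemma compact_space_run_topology: "compact_space (run_topology G)"
  unfolding run_topology_def compact_space_product_topology
  using finite_actions by (simp add: compact_space_discrete_topology)

lemma continuous_map_minmax_value:
  assumes C1: "\<And>n. n \<in> stages G \<Longrightarrow>
      continuous_map (position_topology G n) (discrete_topology (players G)) (active G n)"
    and C2: "continuous_map (run_topology G) euclideanreal (payoff G i)"
  shows "continuous_map (run_topology G) euclideanreal (minmax_value G k i)"
proof (induction k)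
  case 0
  have "minmax_value G 0 i = payoff G i" by auto
  then show ?case using C2 by simp
next
  case (Suc k)
  \<comment> \<open>By (C1) this indicator of \<open>i\<close> being active is continuous, so the
    case distinction becomes a continuous combination of a finite supremum and a finite
    infimum.\<close>
  define c :: "(int \<Rightarrow> 'a) \<Rightarrow> real"
    where "c r = of_bool (active G (- int k) (position_along G r (- int k)) = i)" for r
  have "continuous_map (run_topology G) (discrete_topology (players G))
      (active G (- int k) \<circ> (\<lambda>r. position_along G r (- int k)))"
    by (rule continuous_map_compose[OF continuous_map_position_along C1]) simp
  then have "continuous_map (run_topology G) euclideanreal
      ((\<lambda>j. of_bool (j = i)) \<circ> (active G (- int k) \<circ> (\<lambda>r. position_along G r (- int k))))"
    by (rule continuous_map_compose) simp
  then have c: "continuous_map (run_topology G) euclideanreal c"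
    by (simp add: c_def[abs_def] o_def)
  have upd: "continuous_map (run_topology G) euclideanreal
      (\<lambda>r. minmax_value G k i (r(- int k := b)))" if "b \<in> actions G" for b
    using continuous_map_compose[OF continuous_map_run_upd[OF that] Suc, of "- int k"]
    by (simp add: o_def)
  have "minmax_value G (Suc k) i =
      (\<lambda>r. c r * (SUP b\<in>actions G. minmax_value G k i (r(- int k := b)))
        + (1 - c r) * (INF b\<in>actions G. minmax_value G k i (r(- int k := b))))"
    by (auto simp: c_def)
  moreover have "continuous_map (run_topology G) euclideanreal \<dots>"
    by (intro continuous_intros c upd finite_actions) (auto intro: continuous_intros)
  ultimately show ?case by simp
qed

section \<open>A run that gives every player at least the minmax values\<close>

text \<open>Forward construction from a fixed past: in stage \<open>- int k\<close> the active
  player takes a maximiser of the own value, then the induction hypothesis continues from the new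
  past. Thus no value falls, whoever is active.\<close>

lemma ex_run_minmax_value_le:
  assumes "r0 \<in> runs G"
  shows "\<exists>r\<in>runs G. (\<forall>l\<le>- int k. r l = r0 l) \<and>
    (\<forall>i. \<forall>j\<le>k. minmax_value G j i r \<le> payoff G i r)"
  using assms
proof (induction k arbitrary: r0)
  case 0
  then show ?case by auto
next
  case (Suc k)
  define i0 where "i0 = active G (- int k) (position_along G r0 (- int k))"
  define W where "W b = minmax_value G k i0 (r0(- int k := b))" for b
  \<comment> \<open>A supremum over a nonempty finite set is attained.\<close>
  have "(SUP b\<in>actions G. W b) \<in> W ` actions G"
    using Max_in[of "W ` actions G"] cSup_eq_Max[of "W ` actions G"]
      finite_actions actions_nonempty by simp
  then obtain b where b: "b \<in> actions G" "(SUP b\<in>actions G. W b) = W b"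
    by auto
  define r1 where "r1 = r0(- int k := b)"
  have r1: "r1 \<in> runs G"
    using Suc.prems b by (simp add: r1_def run_upd)
  obtain r where r: "r \<in> runs G" "\<forall>l\<le>- int k. r l = r1 l"
      "\<forall>i. \<forall>j\<le>k. minmax_value G j i r \<le> payoff G i r"
    using Suc.IH[OF r1] by blast
  \<comment> \<open>The continuation \<open>r\<close> changes \<open>r1\<close> only after stage
    \<open>- int k\<close>, which values of index at least \<open>k\<close> do not see.\<close>
  have eq: "minmax_value G j i r = minmax_value G j i r1" if "k \<le> j" for i j
  proof (rule minmax_value_cong)
    fix l assume "l \<le> - int j \<or> 0 < l"
    then show "r l = r1 l"
      using that r(1,2) r1 by (auto simp: runs_def PiE_iff extensional_def)
  qed
  have act: "active G (- int k) (position_along G r1 (- int k)) = i0"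
    unfolding i0_def r1_def
    by (rule arg_cong[of _ _ "active G (- int k)"], rule positions_cong)
      (auto simp: stages_before_def)
  have "minmax_value G (Suc k) i r1 \<le> minmax_value G k i r1" for i
  proof (cases "i = i0")
    case True
    then have "minmax_value G (Suc k) i r1 = (SUP b\<in>actions G. W b)"
      using act by (simp add: W_def r1_def)
    then show ?thesis using b(2) True by (simp add: W_def r1_def)
  next
    case False
    then show ?thesis
      using act b(1) by (intro minmax_value_Suc_le_inactive) (auto simp: r1_def)
  qed
  then have "minmax_value G (Suc k) i r \<le> payoff G i r" for i
    using eq[of k i] eq[of "Suc k" i] r(3) by (metis le_SucI order_refl order_trans)
  then have "\<forall>i. \<forall>j\<le>Suc k. minmax_value G j i r \<le> payoff G i r"
    using r(3) by (metis le_Suc_eq)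
  moreover have "\<forall>l\<le>- int (Suc k). r l = r0 l"
    using r(2) by (simp add: r1_def)
  ultimately show ?case using r(1) by blast
qed

lemma ex_run_minmax_value_le_payoff:
  assumes C1: "\<And>n. n \<in> stages G \<Longrightarrow>
      continuous_map (position_topology G n) (discrete_topology (players G)) (active G n)"
    and C2: "\<And>i. i \<in> players G \<Longrightarrow> continuous_map (run_topology G) euclideanreal (payoff G i)"
  shows "\<exists>r\<in>runs G. \<forall>i\<in>players G. \<forall>k. minmax_value G k i r \<le> payoff G i r"
proof -
  define C where
    "C k = {r \<in> runs G. \<forall>i\<in>players G. \<forall>j\<le>k. minmax_value G j i r \<le> payoff G i r}" for k
  \<comment> \<open>A player is needed for the intersection below to range over a nonempty
    family.\<close>
  obtain i0 where i0: "i0 \<in> players G"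
    using G by (auto simp: infinite_past_game_def)
  have "closedin (run_topology G)
      {r \<in> topspace (run_topology G). minmax_value G j i r - payoff G i r \<in> {..0}}"
    if "i \<in> players G" for i j
    using that
    by (intro closedin_continuous_map_preimage[of _ euclideanreal] continuous_map_diff
        continuous_map_minmax_value C1 C2) auto
  then have "closedin (run_topology G)
      (\<Inter>i\<in>players G. \<Inter>j\<in>{..k}.
        {r \<in> topspace (run_topology G). minmax_value G j i r - payoff G i r \<in> {..0}})" for k
    using i0 by (intro closedin_INT) auto
  moreover have "C k = (\<Inter>i\<in>players G. \<Inter>j\<in>{..k}.
        {r \<in> topspace (run_topology G). minmax_value G j i r - payoff G i r \<in> {..0}})" for k
    using i0 by (auto simp: C_def topspace_run_topology)
  ultimately have closed: "closedin (run_topology G) (C k)" for k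
    by simp
  \<comment> \<open>A constant run serves as the arbitrary past from which each \<open>C k\<close>
    is shown nonempty.\<close>
  obtain a where "a \<in> actions G" using actions_nonempty by blast
  then have "restrict (\<lambda>_. a) {..0} \<in> runs G"
    by (simp add: runs_def)
  then have "C k \<noteq> {}" for k
    using ex_run_minmax_value_le[of _ k] by (fastforce simp: C_def)
  moreover have "decseq C"
    by (auto simp: C_def decseq_def)
  ultimately have "(\<Inter>k. C k) \<noteq> {}"
    by (intro compact_space_imp_nest[OF compact_space_run_topology closed])
  then obtain r where "r \<in> (\<Inter>k. C k)" by blast
  then have "r \<in> C k" for k by blast
  then show ?thesis unfolding C_def by blast
qed

section \<open>Behaviour of the trigger profile and unprofitable deviations\<close>

lemma trigger_profile_in_profiles:
  assumes "r \<in> runs G"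
  shows "trigger_profile G r \<in> profiles G"
proof -
  have "r m \<in> actions G" if "m \<le> 0" for m
    using assms that by (auto simp: runs_def)
  moreover have "arg_min_on f (actions G) \<in> actions G" for f :: "'a \<Rightarrow> real"
    by (rule arg_min_if_finite(1)[OF finite_actions actions_nonempty])
  ultimately show ?thesis
    unfolding trigger_profile_def profiles_def strategies_def Let_def
    by (intro restrict_PiE_iff[THEN iffD2] ballI) (auto simp: controlled_def)
qed

lemma trigger_profile_before_deviation:
  assumes "y \<in> runs G" "m \<le> 0" "\<And>l. l < m \<Longrightarrow> y l = r l"
    and "i = active G m (position_along G y m)"
  shows "trigger_profile G r i (m, position_along G y m) = r m"
proof -
  have D: "{l. l < m \<and> position_along G y m l \<noteq> r l} = {}"
    using assms(2,3) by (auto simp: position_along_def stages_before_def)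
  have "i \<in> players G" "(m, position_along G y m) \<in> controlled G i"
    using assms active_in_players position_along_in_positions by (auto simp: controlled_def)
  then show ?thesis
    unfolding trigger_profile_def Let_def by (simp only: restrict_apply' case_prod_conv D) simp
qed

text \<open>Since \<open>y\<close> and \<open>r\<close> agree before \<open>l\<close>, the set of
  deviations lies in \<open>{l..<m}\<close>, so it is finite with minimum \<open>l\<close>, and the
  deviator found is \<open>j\<close>. The completed run may be replaced by \<open>y\<close>: the two
  agree before \<open>m\<close>, and stage \<open>m\<close> is overwritten.\<close>

lemma trigger_profile_after_deviation:
  assumes y: "y \<in> runs G" and r: "r \<in> runs G" and m: "m = - int k" and l: "l < m"
    and ne: "y l \<noteq> r l" and eq: "\<And>l'. l' < l \<Longrightarrow> y l' = r l'"
    and i: "i = active G m (position_along G y m)"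
    and j: "j = active G l (position_along G r l)"
  shows "trigger_profile G r i (m, position_along G y m)
    = arg_min_on (\<lambda>b. minmax_value G k j (y(m := b))) (actions G)"
proof -
  let ?q = "position_along G y m"
  let ?D = "{l'. l' < m \<and> ?q l' \<noteq> r l'}"
  have q: "?q l' = y l'" if "l' < m" for l'
    using that m by (simp add: position_along_def stages_before_def)
  have "?D \<subseteq> {l..<m}"
    using eq q by (force simp: not_less[symmetric])
  then have fin: "finite ?D"
    by (rule finite_subset) simp
  have lD: "l \<in> ?D"
    using l ne q by simp
  have "Min ?D = l"
    using fin lD \<open>?D \<subseteq> {l..<m}\<close> by (intro Min_eqI) auto
  moreover have "minmax_value G k j ((append_from m ?q r)(m := b)) = minmax_value G k j (y(m := b))"
    for b
    by (rule minmax_value_cong)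
      (use m q y r in \<open>auto simp: append_from_def runs_def PiE_iff extensional_def\<close>)
  moreover have "i \<in> players G" "(m, ?q) \<in> controlled G i"
    using y i m active_in_players position_along_in_positions by (auto simp: controlled_def)
  moreover have "?D \<noteq> {}" using lD by blast
  ultimately show ?thesis
    using fin j m by (simp add: trigger_profile_def Let_def)
qed

text \<open>The first difference \<open>l\<close> must be a move of \<open>i\<close>. From
  \<open>l\<close> on, the value of \<open>i\<close> along \<open>y\<close> never rises: own moves
  cannot raise it, and all others minimise it. So the payoff of \<open>y\<close> is at most the
  value at the last position common to \<open>y\<close> and \<open>r\<close>, which
  \<open>le\<close> bounds by the payoff of \<open>r\<close>.\<close>

lemma deviation_not_profitable:
  assumes r: "r \<in> runs G" and le: "\<And>k. minmax_value G k i r \<le> payoff G i r"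
    and y: "y \<in> runs G" and tail: "\<And>l. l < n \<Longrightarrow> y l = r l"
    and others: "\<And>m j. n \<le> m \<Longrightarrow> m \<le> 0 \<Longrightarrow> j = active G m (position_along G y m) \<Longrightarrow> j \<noteq> i \<Longrightarrow>
      y m = trigger_profile G r j (m, position_along G y m)"
  shows "payoff G i y \<le> payoff G i r"
proof (cases "y = r")
  case False
  define D where "D = {l. y l \<noteq> r l}"
  have D: "D \<subseteq> {n..0}"
    using tail r y by (force simp: D_def not_less[symmetric] runs_def PiE_iff extensional_def)
  then have fin: "finite D" by (rule finite_subset) simp
  have "D \<noteq> {}" using False by (auto simp: D_def)
  define l where "l = Min D"
  have lD: "l \<in> D" using fin \<open>D \<noteq> {}\<close> by (simp add: l_def)
  have l: "n \<le> l" "l \<le> 0" "y l \<noteq> r l" using lD D by (auto simp: D_def)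
  have before: "y l' = r l'" if "l' < l" for l'
    using that fin Min_le[of D l'] by (fastforce simp: D_def l_def)
  have pos: "position_along G y l = position_along G r l"
    by (rule positions_cong) (simp add: before stages_before_def)
  have act: "active G l (position_along G r l) = i"
  proof (rule ccontr)
    assume "active G l (position_along G r l) \<noteq> i"
    then have "y l = r l"
      using others[OF l(1,2) refl] trigger_profile_before_deviation[OF y l(2) before refl] pos
      by simp
    with l(3) show False by simp
  qed
  have step: "minmax_value G k i y \<le> minmax_value G (Suc k) i y" if k: "l \<le> - int k" for k
  proof (cases "active G (- int k) (position_along G y (- int k)) = i")
    case True
    then show ?thesis
      using y by (intro minmax_value_Suc_ge_active) (auto simp: runs_def)
  next
    case False
    let ?W = "\<lambda>b. minmax_value G k i (y(- int k := b))"
    \<comment> \<open>At \<open>l\<close> itself \<open>i\<close> is active, so a stage with another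
      active player comes strictly after the deviation, when punishment is in force.\<close>
    have "l < - int k" using False k act pos by (cases "l = - int k") auto
    then have "y (- int k) = arg_min_on ?W (actions G)"
      using others[OF _ _ refl False] l(1) act
        trigger_profile_after_deviation[OF y r refl _ l(3) before refl, of k i] by simp
    then have "?W (y (- int k)) \<le> ?W b" if "b \<in> actions G" for b
      using arg_min_least[OF finite_actions actions_nonempty that, of ?W] by simp
    then have "?W (y (- int k)) \<le> (INF b\<in>actions G. ?W b)"
      by (intro cINF_greatest actions_nonempty) auto
    then show ?thesis using False by simp
  qed
  have chain: "payoff G i y \<le> minmax_value G k i y" if "l \<le> 1 - int k" for k
    using that
  proof (induction k)
    case (Suc k)
    then show ?case using step[of k] by linarith
  qed simp
  \<comment> \<open>With this index the value belongs to the position in stage \<open>l\<close>,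
    before the deviating action, where \<open>y\<close> and \<open>r\<close> still coincide.\<close>
  define k where "k = Suc (nat (- l))"
  have k: "1 - int k = l" using l(2) by (simp add: k_def)
  have "minmax_value G k i y = minmax_value G k i r"
  proof (rule minmax_value_cong)
    fix l' assume "l' \<le> - int k \<or> 0 < l'"
    then show "y l' = r l'"
      using before[of l'] k r y by (auto simp: runs_def PiE_iff extensional_def)
  qed
  then show ?thesis
    using chain[of k] le[of k] k by simp
qed simp

section \<open>Nash equilibrium in the subgames along the run\<close>

lemma append_from_position_along:
  assumes "n \<le> m" "m \<le> 0"
  shows "append_from n (position_along G r n) (position_along (subgame G n p) z m)
    = position_along G (append_from n (position_along G r n) z) m"
  using assms
  by (auto simp: append_from_def position_along_def subgame_def stages_before_def restrict_def)

lemma append_from_restrict: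
  assumes "r \<in> runs G" "n \<le> 0"
  shows "append_from n (position_along G r n) (restrict r {n..0}) = r"
  using assms
  by (auto simp: append_from_def position_along_def stages_before_def restrict_def runs_def
      PiE_iff extensional_def)

text \<open>The induced profile has the rest of \<open>r\<close> as its outcome. Prepending the past
  of \<open>r\<close> to the outcome of a unilateral deviation gives a run of \<open>G\<close> on
  which all others follow the trigger profile, so \<open>deviation_not_profitable\<close>
  applies.\<close>

lemma nash_equilibrium_trigger_profile:
  assumes r: "r \<in> runs G"
    and le: "\<And>i k. i \<in> players G \<Longrightarrow> minmax_value G k i r \<le> payoff G i r"
    and n: "n \<le> 0"
  shows "nash_equilibrium (subgame G n (position_along G r n))
    (induced_profile G (trigger_profile G r) n (position_along G r n))"
proof -
  let ?p = "position_along G r n"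
  let ?F = "subgame G n ?p"
  let ?t = "induced_profile G (trigger_profile G r) n ?p"
  have n': "n \<in> stages G" using n by simp
  have p: "?p \<in> positions G n" by (rule position_along_in_positions[OF r])
  note ex1 = ex1_consistent_run_subgame[OF G n' p]
  have F: "players ?F = players G" "stages ?F = {n..0}" "runs ?F = {n..0} \<rightarrow>\<^sub>E actions G"
    "\<And>m h. active ?F m h = active G m (append_from n ?p h)"
    "\<And>i h. payoff ?F i h = payoff G i (append_from n ?p h)"
    by (auto simp: subgame_def runs_def)
  have induced: "?t j (m, position_along ?F z m) =
      trigger_profile G r j (m, position_along G (append_from n ?p z) m)"
    if "z \<in> runs ?F" "n \<le> m" "m \<le> 0" "j \<in> players G"
      "j = active G m (position_along G (append_from n ?p z) m)" for z m j
    using that position_along_in_positions[OF that(1), of m]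
    by (simp add: induced_profile_def controlled_def F append_from_position_along)
  have prof: "?t \<in> profiles ?F"
    by (rule induced_profile_in_profiles[OF G n' p trigger_profile_in_profiles[OF r]])
  let ?z = "restrict r {n..0}"
  have z: "?z \<in> runs ?F" unfolding F using r by (auto simp: runs_def)
  have "?z \<in> consistent_runs ?F ?t"
    unfolding consistent_runs_def consistent_def
  proof (intro CollectI conjI z ballI impI)
    fix i m
    assume *: "i \<in> players ?F" "m \<in> stages ?F" "active ?F m (position_along ?F ?z m) = i"
    then have m: "n \<le> m" "m \<le> 0" by (auto simp: F)
    have i: "i = active G m (position_along G r m)"
      using *(3) m n by (simp add: F append_from_position_along append_from_restrict r)
    have "?t i (m, position_along ?F ?z m) = trigger_profile G r i (m, position_along G r m)"
      using induced[OF z m] * i n by (simp add: F append_from_restrict r)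
    also have "\<dots> = r m"
      using trigger_profile_before_deviation[OF r m(2) refl i] .
    finally show "?z m = ?t i (m, position_along ?F ?z m)"
      using m by simp
  qed
  \<comment> \<open>Exhibiting one consistent run suffices, since it is unique in a finite
    game.\<close>
  then have out: "outcome ?F ?t = ?z"
    unfolding outcome_def using ex1[OF prof] by (intro the1_equality)
  have "payoff ?F i (outcome ?F (?t(i := t))) \<le> payoff ?F i (outcome ?F ?t)"
    if i: "i \<in> players ?F" and t: "t \<in> strategies ?F i" for i t
  proof -
    have "?t(i := t) \<in> profiles ?F"
      using prof i t by (auto simp: profiles_def PiE_iff extensional_def)
    then have "outcome ?F (?t(i := t)) \<in> consistent_runs ?F (?t(i := t))"
      unfolding outcome_def by (rule theI'[OF ex1])
    then obtain z where z_def: "z = outcome ?F (?t(i := t))"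
      and z: "z \<in> runs ?F"
      and cons: "\<And>j m. j \<in> players G \<Longrightarrow> n \<le> m \<Longrightarrow> m \<le> 0 \<Longrightarrow>
        active ?F m (position_along ?F z m) = j \<Longrightarrow>
        z m = (?t(i := t)) j (m, position_along ?F z m)"
      by (auto simp: consistent_runs_def consistent_def F)
    let ?y = "append_from n ?p z"
    have y: "?y \<in> runs G" by (rule append_from_in_runs[OF G n' p z])
    have "payoff G i ?y \<le> payoff G i r"
    proof (rule deviation_not_profitable[OF r _ y])
      show "minmax_value G k i r \<le> payoff G i r" for k
        using le i by (simp add: F)
      show "?y l = r l" if "l < n" for l
        using that n by (simp add: append_from_def position_along_def stages_before_def)
    next
      fix m j
      assume m: "n \<le> m" "m \<le> 0" and j: "j = active G m (position_along G ?y m)" and ji: "j \<noteq> i"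
      have jp: "j \<in> players G" using j active_in_players[OF y m(2)] by simp
      have "z m = ?t j (m, position_along ?F z m)"
        using cons[OF jp m] j ji m by (simp add: F append_from_position_along)
      also have "\<dots> = trigger_profile G r j (m, position_along G ?y m)"
        by (rule induced[OF z m jp j])
      finally show "?y m = trigger_profile G r j (m, position_along G ?y m)"
        using m by (simp add: append_from_def)
    qed
    then show ?thesis
      using out n by (simp add: F append_from_restrict r z_def)
  qed
  with prof show ?thesis by (simp add: nash_equilibrium_def)
qed

lemma trigger_profile_consistent:
  assumes r: "r \<in> runs G"
  shows "r \<in> consistent_runs G (trigger_profile G r)"
  using r trigger_profile_before_deviation[OF r _ refl refl]
  by (auto simp: consistent_runs_def consistent_def)

end

theorem theorem45:
  fixes G :: "('i, 'a) game"
  assumes "infinite_past_game G"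
    and C1: "\<And>n. n \<in> stages G \<Longrightarrow>
      continuous_map (position_topology G n) (discrete_topology (players G)) (active G n)"
    and C2: "\<And>i. i \<in> players G \<Longrightarrow> continuous_map (run_topology G) euclideanreal (payoff G i)"
  shows "\<exists>s r. equilibrium G s r"
proof -
  note G = \<open>infinite_past_game G\<close>
  obtain r where r: "r \<in> runs G"
    and le: "\<And>i k. i \<in> players G \<Longrightarrow> minmax_value G k i r \<le> payoff G i r"
    using ex_run_minmax_value_le_payoff[OF G C1 C2] by blast
  have "equilibrium G (trigger_profile G r) r"
    using trigger_profile_in_profiles[OF G r] trigger_profile_consistent[OF G r]
      nash_equilibrium_trigger_profile[OF G r le] stages_eq[OF G]
    by (simp add: equilibrium_def)
  then show ?thesis by blast
qed

end
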